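(* Let $\mathbf{n}\in\mathbb{R}^3$ be a unit vector, let $\theta\in(-\pi,\pi)$, and let $\mathbf{Q}=\tan(\theta/2)\,\mathbf{n}$ be the Rodrigues' vector of the rotation of angle $\theta$ about the axis through the origin oriented by $\mathbf{n}$. Then for every $\mathbf{x}\in\mathbb{R}^3$ the vector $\mathbf{Q}\times\mathbf{x}$ is tangent at $\mathbf{x}$ to the arc described by $\mathbf{x}$ as it rotates about the axis, and it connects $\mathbf{x}$ to the bisector of the rotation angle. That is, $\mathbf{Q}\times\mathbf{x}$ is a scalar multiple of the derivative at $\varphi=0$ of the curve $\varphi\mapsto\mathbf{R}(\mathbf{n},\varphi)\mathbf{x}$, and $\mathbf{x}+\mathbf{Q}\times\mathbf{x}\in B(\mathbf{x})$, where $B(\mathbf{x})$ denotes the bisector of the rotation angle at $\mathbf{x}$.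
   Context: For a unit vector $\mathbf{n}\in\mathbb{R}^3$ and $\varphi\in\mathbb{R}$, $\mathbf{R}(\mathbf{n},\varphi)$ denotes the (active, right-handed) rotation of $\mathbb{R}^3$ of angle $\varphi$ about the axis $\mathbb{R}\mathbf{n}$ through the origin, i.e. $\mathbf{R}(\mathbf{n},\varphi)\mathbf{x}=\cos\varphi\,\mathbf{x}+\sin\varphi\,(\mathbf{n}\times\mathbf{x})+(1-\cos\varphi)(\mathbf{n}\cdot\mathbf{x})\mathbf{n}$. The Rodrigues' vector of the rotation $\mathbf{R}(\mathbf{n},\theta)$, with $\theta\in(-\pi,\pi)$, is $\mathbf{Q}=\tan(\theta/2)\,\mathbf{n}$. The arc described by $\mathbf{x}$ under the rotation is $\{\mathbf{R}(\mathbf{n},\varphi)\mathbf{x}:\varphi\text{ between }0\text{ and }\theta\}$; it lies in the plane through $\mathbf{x}$ perpendicular to $\mathbf{n}$ and has center $\mathbf{c}=(\mathbf{n}\cdot\mathbf{x})\mathbf{n}$. The bisector of the rotation angle at $\mathbf{x}$ is the ray in that plane from the center through the midpoint of the arc: $B(\mathbf{x})=\{\mathbf{c}+s\,\mathbf{R}(\mathbf{n},\theta/2)(\mathbf{x}-\mathbf{c}): s\ge 0\}$. *)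

theory Defs
  imports "HOL-Analysis.Analysis"
begin

(* Active, right-handed rotation of angle \<phi> about the axis through the origin oriented by the
   unit vector n; the formula describes a rotation only when norm n = 1. *)
definition axis_rotation :: "real^3 \<Rightarrow> real \<Rightarrow> real^3 \<Rightarrow> real^3" where
  "axis_rotation n \<phi> x =
     cos \<phi> *\<^sub>R x + sin \<phi> *\<^sub>R cross3 n x + ((1 - cos \<phi>) * (n \<bullet> x)) *\<^sub>R n"

definition rodrigues_vector :: "real^3 \<Rightarrow> real \<Rightarrow> real^3" where
  "rodrigues_vector n \<theta> = tan (\<theta> / 2) *\<^sub>R n"

definition arc_center :: "real^3 \<Rightarrow> real^3 \<Rightarrow> real^3" where
  "arc_center n x = (n \<bullet> x) *\<^sub>R n"

(* The ray from the center of the arc described by x through the midpoint of that arc.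
   It degenerates to the single point x when x lies on the axis. *)
definition angle_bisector :: "real^3 \<Rightarrow> real \<Rightarrow> real^3 \<Rightarrow> (real^3) set" where
  "angle_bisector n \<theta> x =
     {arc_center n x + s *\<^sub>R axis_rotation n (\<theta> / 2) (x - arc_center n x) | s. s \<ge> 0}"

end

theory Submission
  imports Defs
begin

text \<open>Let y be the component of x orthogonal to n, so that n x y = n x x (cross products). The
  axial term of the rotation vanishes on y, so the half-angle rotation sends y to cos(\<theta>/2) y
  + sin(\<theta>/2) (n x x). Dividing by cos(\<theta>/2) gives y + Q x x: the bisector is met at
  parameter 1/cos(\<theta>/2). Tangency holds because Q is a multiple of n and the velocity at angle
  0 is n x x.\<close>

theorem mainTheorem1:
  fixes n x :: "real^3" and \<theta> :: real
  assumes "norm n = 1" and "\<theta> \<in> {-pi<..<pi}"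
  shows "(\<exists>v k. ((\<lambda>\<phi>. axis_rotation n \<phi> x) has_vector_derivative v) (at 0) \<and>
             cross3 (rodrigues_vector n \<theta>) x = k *\<^sub>R v) \<and>
         x + cross3 (rodrigues_vector n \<theta>) x \<in> angle_bisector n \<theta> x"
proof -
  define y where "y = x - arc_center n x"
  have nn: "n \<bullet> n = 1"
    using assms(1) by (simp add: dot_square_norm)
  have ny: "n \<bullet> y = 0"
    by (simp add: y_def arc_center_def inner_diff_right nn)
  have cross_y: "cross3 n y = cross3 n x"
    by (simp add: y_def arc_center_def Cross3.right_diff_distrib cross_mult_right cross_refl)
  have cross_Q: "cross3 (rodrigues_vector n \<theta>) x = tan (\<theta> / 2) *\<^sub>R cross3 n x"
    by (simp add: rodrigues_vector_def cross_mult_left)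
  \<comment> \<open>The half-angle lies strictly between -pi/2 and pi/2; positivity of its cosine
    permits the division and puts the point on the ray, not merely on its line.\<close>
  have cos_pos: "cos (\<theta> / 2) > 0"
    using assms(2) by (intro cos_gt_zero_pi) auto
  have "((\<lambda>\<phi>. axis_rotation n \<phi> x) has_vector_derivative cross3 n x) (at 0)"
    unfolding axis_rotation_def by (auto intro!: derivative_eq_intros)
  moreover have "x + cross3 (rodrigues_vector n \<theta>) x
      = arc_center n x + (1 / cos (\<theta> / 2)) *\<^sub>R axis_rotation n (\<theta> / 2) y"
    \<comment> \<open>\<open>y\<close> stays folded at first so that \<open>ny\<close> and
      \<open>cross_y\<close> can rewrite; unfolding it then recombines center and \<open>y\<close>
      into \<open>x\<close>.\<close>
    using cos_pos
    by (simp add: cross_Q axis_rotation_def ny cross_y scaleR_add_right tan_def)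
       (simp add: y_def)
  then have "x + cross3 (rodrigues_vector n \<theta>) x \<in> angle_bisector n \<theta> x"
    using cos_pos unfolding angle_bisector_def y_def
    by (intro CollectI exI[of _ "1 / cos (\<theta> / 2)"]) simp
  ultimately show ?thesis
    using cross_Q by blast
qed

end
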